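(* Let $G=(V,E)$ be a graph on $n$ vertices and let $k,s$ be integers with $1<s<k$. For integers $N,K,s$ put $$f(N,K,s)=\sum_{i=0}^{\lfloor K/(s+1)\rfloor}(-1)^i\binom{N}{i}\binom{N+K-1-i(s+1)}{N-1}\quad (K\ge 1),\qquad f(N,0,s)=1.$$ Then the order and the size of the supertoken graph $F_k^s(G)$ are, respectively, $$|V(F_k^s(G))|=f(n,k,s)$$ and $$|E(F_k^s(G))|=|E|\left(\sum_{i=1}^{s} i\, f(n-2,k-i,s)+\sum_{j=1}^{\omega-s+1}(s-j)\,f(n-2,k-s-j,s)\right),$$ where $\omega=\min\{2s-2,\,k-1\}$.
   Context: Graphs are finite, simple and undirected. For a graph $G=(V,E)$ and integers $1\le s\le k$, the supertoken graph $F_k^s(G)$ has as vertices the multisets of $k$ elements of $V$ in which every vertex of $G$ has multiplicity at most $s$ (distributions of $k$ identical tokens on the vertices of $G$ with at most $s$ tokens per vertex). Two such multisets are adjacent if one is obtained from the other by replacing one occurrence of a vertex $u$ by a vertex $v$ with $uv\in E$ (moving one token along an edge of $G$). Binomial coefficients with negative lower index are equal to $0$. *)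

theory Defs
  imports Complex_Main "HOL-Library.Multiset"
begin

record 'a graph =
  verts :: "'a set"
  edges :: "'a set set"

definition fin_simple_graph :: "'a graph \<Rightarrow> bool" where
  "fin_simple_graph G \<longleftrightarrow>
     finite (verts G) \<and> (\<forall>e\<in>edges G. e \<subseteq> verts G \<and> card e = 2)"

definition token_configs :: "'a set \<Rightarrow> nat \<Rightarrow> nat \<Rightarrow> 'a multiset set" where
  "token_configs V k s = {M. set_mset M \<subseteq> V \<and> size M = k \<and> (\<forall>v\<in>V. count M v \<le> s)}"

definition token_move :: "'a graph \<Rightarrow> 'a multiset \<Rightarrow> 'a multiset \<Rightarrow> bool" where
  "token_move G M M' \<longleftrightarrow>
     (\<exists>u v. {u, v} \<in> edges G \<and> u \<in># M \<and> M' = add_mset v (M - {#u#}))"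

definition supertoken_graph :: "'a graph \<Rightarrow> nat \<Rightarrow> nat \<Rightarrow> 'a multiset graph" where
  "supertoken_graph G k s =
     \<lparr>verts = token_configs (verts G) k s,
      edges = {{M, M'} | M M'. M \<in> token_configs (verts G) k s \<and>
                 M' \<in> token_configs (verts G) k s \<and> token_move G M M'}\<rparr>"

text \<open>
  Binomial coefficients with integer arguments, equal to \<open>0\<close> for a negative lower index. The
  arguments of the counting function below are integers, since \<open>N - 1\<close> can be negative:
  it occurs with \<open>N = n - 2\<close>. The values are real only because \<open>gchoose\<close> is set up
  for fields.
\<close>

definition zbinom :: "int \<Rightarrow> int \<Rightarrow> real" where
  "zbinom a b = (if b < 0 then 0 else of_int a gchoose nat b)"

text \<open>The mathematical definition concerns \<open>K \<ge> 0\<close> only. On \<open>int\<close>, \<open>div\<close> rounds down.\<close>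

definition token_count :: "int \<Rightarrow> int \<Rightarrow> int \<Rightarrow> real" where
  "token_count N K s =
     (if K = 0 then 1
      else \<Sum>i = 0..K div (s + 1).
             (-1) ^ nat i * zbinom N i * zbinom (N + K - 1 - i * (s + 1)) (N - 1))"

lemma fin_simple_graph_supertoken_graph:
  assumes "fin_simple_graph G"
  shows "fin_simple_graph (supertoken_graph G k s)"
proof -
  have fin: "finite (verts G)" using assms by (simp add: fin_simple_graph_def)
  have "finite {M. set_mset M \<subseteq> verts G \<and> size M = k}"
  proof (rule finite_subset)
    show "{M. set_mset M \<subseteq> verts G \<and> size M = k}
            \<subseteq> mset ` {xs. set xs \<subseteq> verts G \<and> length xs = k}"
    proof
      fix M assume "M \<in> {M. set_mset M \<subseteq> verts G \<and> size M = k}"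
      moreover obtain xs where "mset xs = M" using ex_mset by blast
      ultimately show "M \<in> mset ` {xs. set xs \<subseteq> verts G \<and> length xs = k}" by auto
    qed
    show "finite (mset ` {xs. set xs \<subseteq> verts G \<and> length xs = k})"
      using fin by (intro finite_imageI finite_lists_length_eq)
  qed
  hence "finite (token_configs (verts G) k s)"
    by (rule rev_finite_subset) (auto simp: token_configs_def)
  moreover have "M \<noteq> M'" if "token_move G M M'" for M M'
  proof
    assume eq: "M = M'"
    from that obtain u v where uv: "{u, v} \<in> edges G" "u \<in># M"
      and M': "M' = add_mset v (M - {#u#})" by (auto simp: token_move_def)
    from uv(1) assms have "card {u, v} = 2" by (auto simp: fin_simple_graph_def)
    hence "u \<noteq> v" by auto
    hence "count M' u = count M u - 1" by (simp add: M')
    moreover have "count M u > 0" using uv(2) by simp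
    ultimately show False unfolding eq by linarith
  qed
  ultimately show ?thesis
    by (auto simp: fin_simple_graph_def supertoken_graph_def)
qed

end

theory Submission
  imports Defs "HOL-Computational_Algebra.Formal_Power_Series"
begin

text \<open>
  The number of configurations of \<open>K\<close> tokens with at most \<open>b v\<close> tokens on \<open>v\<close> is the coefficient of
  \<open>X^K\<close> in the product over \<open>v\<close> of \<open>1 + X + ... + X^(b v)\<close>. For constant \<open>b = s\<close> on \<open>N\<close> vertices,
  expanding \<open>(1 - X^(s+1))^N (1 - X)^(-N)\<close> gives the alternating sum \<open>f(N,K,s)\<close>. An edge of the
  supertoken graph is an edge \<open>uv\<close> of \<open>G\<close> together with a configuration of the other \<open>k - 1\<close>
  tokens with at most \<open>s - 1\<close> of them on each of \<open>u\<close> and \<open>v\<close>. The coefficients of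
  \<open>(1 + X + ... + X^(s-1))^2\<close> are \<open>1, 2, ..., s, s - 1, ..., 1\<close>, which yields the two sums of
  the size formula.
\<close>

unbundle fps_syntax

section \<open>Multisets with bounded multiplicities and their generating function\<close>

text \<open>The bound depends on the vertex because, in the edge count, the two endpoints of the
  used edge get the bound \<open>s - 1\<close> and all other vertices \<open>s\<close>.\<close>

definition bounded_multisets :: "'a set \<Rightarrow> ('a \<Rightarrow> nat) \<Rightarrow> nat \<Rightarrow> 'a multiset set" where
  "bounded_multisets V b k = {M. set_mset M \<subseteq> V \<and> size M = k \<and> (\<forall>v\<in>V. count M v \<le> b v)}"

definition fps_geom :: "nat \<Rightarrow> real fps" where
  "fps_geom r = Abs_fps (\<lambda>i. if i \<le> r then 1 else 0)"

lemma fps_geom_nth [simp]: "fps_geom r $ i = (if i \<le> r then 1 else 0)"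
  by (simp add: fps_geom_def)

lemma bounded_multisets_empty:
  "bounded_multisets {} b k = (if k = 0 then {{#}} else {})"
  by (auto simp: bounded_multisets_def)

text \<open>Classification by the multiplicity \<open>i\<close> of the new vertex; the cap
  \<open>i \<le> k\<close> keeps the subtraction \<open>k - i\<close> exact.\<close>

lemma bounded_multisets_insert:
  assumes "v \<notin> V"
  shows "bounded_multisets (insert v V) b k =
    (\<Union>i\<in>{..min k (b v)}. (\<lambda>M. M + replicate_mset i v) ` bounded_multisets V b (k - i))"
    (is "?L = ?R")
proof
  show "?L \<subseteq> ?R"
  proof
    fix M assume M: "M \<in> ?L"
    define N where "N = filter_mset (\<lambda>x. x \<noteq> v) M"
    have MN: "M = N + replicate_mset (count M v) v"
      by (rule multiset_eqI) (auto simp: N_def)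
    have "size M = size N + count M v" by (subst MN) simp
    moreover have "count N w = count M w" if "w \<in> V" for w
      using that assms by (auto simp: N_def)
    ultimately have "N \<in> bounded_multisets V b (k - count M v)" "count M v \<le> min k (b v)"
      using M by (auto simp: bounded_multisets_def N_def)
    with MN show "M \<in> ?R" by blast
  qed
  show "?R \<subseteq> ?L"
  proof
    fix M assume "M \<in> ?R"
    then obtain i N where i: "i \<le> k" "i \<le> b v" and N: "N \<in> bounded_multisets V b (k - i)"
      and M: "M = N + replicate_mset i v" by auto
    have "count N v = 0"
      using N assms by (auto simp: bounded_multisets_def simp flip: not_in_iff)
    then show "M \<in> ?L"
      using i N assms by (auto simp: bounded_multisets_def M split: if_splits)
  qed
qed

lemma finite_bounded_multisets:
  "finite V \<Longrightarrow> finite (bounded_multisets V b k)"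
  by (induction V arbitrary: k rule: finite_induct)
    (simp_all add: bounded_multisets_empty bounded_multisets_insert)

text \<open>Splitting off one vertex is a Cauchy product with its factor
  \<open>fps_geom (b v)\<close>. The induction needs all \<open>k\<close> at once, since
  \<open>k - i\<close> tokens remain for the other vertices.\<close>

lemma card_bounded_multisets:
  "finite V \<Longrightarrow> real (card (bounded_multisets V b k)) = (\<Prod>v\<in>V. fps_geom (b v)) $ k"
proof (induction V arbitrary: k rule: finite_induct)
  case empty
  show ?case by (simp add: bounded_multisets_empty)
next
  case (insert v V)
  let ?F = "\<lambda>i. (\<lambda>M. M + replicate_mset i v) ` bounded_multisets V b (k - i)"
  \<comment> \<open>The index of a piece can be read off from any of its members, so the pieces are
    disjoint.\<close>
  have mult: "i = count M v" if "M \<in> ?F i" for M i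
    using that insert.hyps(2) by (auto simp: bounded_multisets_def count_eq_zero_iff subset_iff)
  have disj: "?F i \<inter> ?F j = {}" if "i \<noteq> j" for i j
    using mult that by blast
  have card_F: "card (?F i) = card (bounded_multisets V b (k - i))" for i
    by (rule card_image) (auto simp: inj_on_def)
  have "card (bounded_multisets (insert v V) b k) = (\<Sum>i\<le>min k (b v). card (?F i))"
    unfolding bounded_multisets_insert[OF insert.hyps(2)]
    using disj insert.hyps(1) by (intro card_UN_disjoint) (auto simp: finite_bounded_multisets)
  also have "real \<dots> = (\<Sum>i\<le>min k (b v). (\<Prod>v\<in>V. fps_geom (b v)) $ (k - i))"
    by (simp only: card_F insert.IH of_nat_sum)
  also have "\<dots> = (\<Sum>i=0..k. fps_geom (b v) $ i * (\<Prod>v\<in>V. fps_geom (b v)) $ (k - i))"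
    by (rule sum.mono_neutral_cong_left) auto
  finally show ?case
    using insert.hyps by (simp add: fps_mult_nth)
qed

section \<open>The alternating sum as a power series coefficient\<close>

abbreviation fps_ones :: "real fps" where
  "fps_ones \<equiv> Abs_fps (\<lambda>_. 1)"

text \<open>\<open>fps_ones\<close> is 1/(1 - X), and multiplying by it forms partial sums, so the
  induction step is the hockey-stick identity. The exponent 0 is excluded: its coefficients do not
  fit the binomial formula.\<close>

lemma fps_ones_power_nth: "(fps_ones ^ Suc m) $ n = real ((m + n) choose m)"
proof (induction m arbitrary: n)
  case 0
  show ?case by simp
next
  case (Suc m)
  have "(fps_ones ^ Suc (Suc m)) $ n = (\<Sum>i=0..n. (fps_ones ^ Suc m) $ i)"
    by (subst power_Suc2) (simp only: fps_mult_nth fps_nth_Abs_fps mult_1_right)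
  also have "\<dots> = (\<Sum>i\<le>n. real ((m + i) choose m))"
    by (simp only: Suc.IH atLeast0AtMost)
  also have "\<dots> = real ((m + n + 1) choose (m + 1))"
    by (simp only: choose_rising_sum(1) flip: of_nat_sum)
  finally show ?case by simp
qed

lemma fps_geom_closed_form: "fps_geom s = (1 - fps_X ^ Suc s) * fps_ones"
  by (rule fps_ext) (auto simp: left_diff_distrib fps_X_power_mult_nth simp del: power_Suc)

text \<open>The binomial theorem expands the power of \<open>1 - fps_X ^ Suc s\<close>, and each
  power of \<open>fps_X\<close> shifts the coefficients of \<open>fps_ones ^ N\<close>.\<close>

lemma fps_geom_power_nth:
  "(fps_geom s ^ N) $ K =
     (\<Sum>i\<le>K div Suc s. (-1) ^ i * real (N choose i) * (fps_ones ^ N) $ (K - i * Suc s))"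
proof -
  \<comment> \<open>The cutoff is explicit because for larger \<open>i\<close> the truncated
    \<open>K - i * Suc s\<close> would select the constant coefficient, whereas the shifted series
    has coefficient 0 there.\<close>
  let ?g = "\<lambda>i. (-1) ^ i * real (N choose i) *
    (if i \<le> K div Suc s then (fps_ones ^ N) $ (K - i * Suc s) else 0)"
  have le_div: "K < Suc s * i \<longleftrightarrow> \<not> i \<le> K div Suc s" for i
    by (simp add: less_eq_div_iff_mult_less_eq mult.commute not_le del: mult_Suc mult_Suc_right)
  have term_nth: "((of_nat (N choose i) * (- (fps_X ^ Suc s)) ^ i) * fps_ones ^ N) $ K = ?g i" for i
  proof -
    have "(of_nat (N choose i) * (- (fps_X ^ Suc s)) ^ i) * fps_ones ^ N =
        fps_const ((-1) ^ i * real (N choose i)) * (fps_X ^ (Suc s * i) * fps_ones ^ N)"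
      by (subst power_minus)
        (simp add: power_mult[symmetric] fps_of_nat[symmetric] fps_const_neg[symmetric] fps_const_power[symmetric]
          fps_const_mult[symmetric] mult_ac
          del: power_Suc mult_Suc mult_Suc_right fps_const_neg fps_const_power fps_const_mult)
    then show ?thesis
      by (simp only: fps_mult_left_const_nth fps_X_power_mult_nth le_div mult.commute[of i]) simp
  qed
  have "fps_geom s ^ N = (- (fps_X ^ Suc s) + 1) ^ N * fps_ones ^ N"
    by (simp add: fps_geom_closed_form power_mult_distrib)
  also have "\<dots> = (\<Sum>i\<le>N. (of_nat (N choose i) * (- (fps_X ^ Suc s)) ^ i) * fps_ones ^ N)"
    by (simp only: binomial_ring power_one mult_1_right sum_distrib_right)
  finally have "(fps_geom s ^ N) $ K = (\<Sum>i\<le>N. ?g i)"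
    by (simp only: fps_sum_nth term_nth)
  \<comment> \<open>The binomial expansion stops at \<open>N\<close>, the target sum at
    \<open>K div Suc s\<close>. Both extend to the maximum: \<open>N choose i\<close> vanishes
    beyond the first limit, the cutoff beyond the second.\<close>
  also have "\<dots> = (\<Sum>i\<le>max N (K div Suc s). ?g i)"
    by (rule sum.mono_neutral_left) auto
  also have "\<dots> = (\<Sum>i\<le>K div Suc s. (-1) ^ i * real (N choose i) * (fps_ones ^ N) $ (K - i * Suc s))"
    by (rule sum.mono_neutral_cong_right) auto
  finally show ?thesis .
qed

lemma zbinom_of_nat: "zbinom (int a) (int b) = real (a choose b)"
  by (simp add: zbinom_def binomial_gbinomial)

lemma token_count_eq_fps_nth:
  "token_count (int N) (int K) (int s) = (fps_geom s ^ N) $ K"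
proof (cases "K = 0")
  case True
  then show ?thesis by (simp add: token_count_def fps_nth_power_0)
next
  case K: False
  have "token_count (int N) (int K) (int s) =
      (\<Sum>i\<in>int ` {..K div Suc s}. (-1) ^ nat i * zbinom (int N) i *
         zbinom (int N + int K - 1 - i * (int s + 1)) (int N - 1))"
  proof -
    have "int ` {..K div Suc s} = {0..int K div (int s + 1)}"
      using image_int_atLeastAtMost[of 0 "K div Suc s"]
      by (simp add: zdiv_int atMost_atLeast0 add.commute)
    then show ?thesis using K by (simp add: token_count_def)
  qed
  also have "\<dots> = (\<Sum>i\<le>K div Suc s. (-1) ^ i * real (N choose i) *
      zbinom (int N + int K - 1 - int i * (int s + 1)) (int N - 1))"
    by (subst sum.reindex) (simp_all add: zbinom_of_nat)
  also have "\<dots> = (\<Sum>i\<le>K div Suc s. (-1) ^ i * real (N choose i) * (fps_ones ^ N) $ (K - i * Suc s))"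
  proof (rule sum.cong[OF refl])
    fix i assume "i \<in> {..K div Suc s}"
    then have le: "i * Suc s \<le> K"
      by (simp add: less_eq_div_iff_mult_less_eq del: mult_Suc_right)
    show "(-1) ^ i * real (N choose i) * zbinom (int N + int K - 1 - int i * (int s + 1)) (int N - 1) =
        (-1) ^ i * real (N choose i) * (fps_ones ^ N) $ (K - i * Suc s)"
    proof (cases N)
      case 0
      \<comment> \<open>On the left the lower index is -1, so \<open>zbinom\<close> gives 0. On the
        right \<open>0 choose i\<close> vanishes for positive \<open>i\<close>, and for
        \<open>i = 0\<close> the series 1 has no coefficient at \<open>K > 0\<close>.\<close>
      then show ?thesis using K by (cases i) (auto simp: zbinom_def)
    next
      case (Suc m)
      have "int N + int K - 1 - int i * (int s + 1) = int (m + (K - i * Suc s))"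
        using le Suc by (simp add: of_nat_diff algebra_simps)
      moreover have "int N - 1 = int m" using Suc by simp
      ultimately show ?thesis
        by (simp only: zbinom_of_nat fps_ones_power_nth Suc)
    qed
  qed
  finally show ?thesis by (simp only: fps_geom_power_nth)
qed

section \<open>Counting the edges of the supertoken graph\<close>

lemma token_configs_eq: "token_configs V k s = bounded_multisets V (\<lambda>_. s) k"
  by (simp add: token_configs_def bounded_multisets_def)

text \<open>An edge of the supertoken graph is determined by the edge of \<open>G\<close> that is used and by the
  multiset \<open>P\<close> of the tokens that stay; no orientation of the edges of \<open>G\<close> needs to be chosen.\<close>

lemma edges_supertoken_graph:
  assumes G: "fin_simple_graph G" and "0 < k" "0 < s"
  shows "edges (supertoken_graph G k s) =
    (\<lambda>(e, P). (\<lambda>w. add_mset w P) ` e) `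
      (SIGMA e:edges G. bounded_multisets (verts G) (\<lambda>w. if w \<in> e then s - 1 else s) (k - 1))"
    (is "?L = ?f ` ?S")
proof
  show "?L \<subseteq> ?f ` ?S"
  proof
    fix x assume "x \<in> ?L"
    then obtain M M' u v where x: "x = {M, M'}" and M: "M \<in> token_configs (verts G) k s"
      and M': "M' \<in> token_configs (verts G) k s" and uv: "{u, v} \<in> edges G" "u \<in># M"
      and M'_eq: "M' = add_mset v (M - {#u#})"
      by (auto simp: supertoken_graph_def token_move_def)
    define P where "P = M - {#u#}"
    have M_eq: "M = add_mset u P" using uv(2) by (simp add: P_def)
    from G uv(1) have "card {u, v} = 2"
      by (auto simp: fin_simple_graph_def)
    then have ne: "u \<noteq> v" by auto
    have cM: "count M w \<le> s" "count M' w \<le> s" if "w \<in> verts G" for w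
      using M M' that by (auto simp: token_configs_def)
    \<comment> \<open>\<open>P\<close> has one \<open>u\<close> less than \<open>M\<close> and one
      \<open>v\<close> less than \<open>M'\<close>, so each endpoint holds at most
      \<open>s - 1\<close> of the tokens that stay.\<close>
    have "count P w \<le> (if w \<in> {u, v} then s - 1 else s)" if "w \<in> verts G" for w
      using cM[OF that] ne by (auto simp: M_eq M'_eq split: if_splits)
    moreover have "set_mset P \<subseteq> verts G" "size P = k - 1"
      using M by (auto simp: token_configs_def M_eq)
    ultimately have "({u, v}, P) \<in> ?S"
      using uv(1) by (auto simp: bounded_multisets_def)
    moreover have "x = ?f ({u, v}, P)"
      using M_eq M'_eq P_def x by simp
    ultimately show "x \<in> ?f ` ?S" by blast
  qed
  show "?f ` ?S \<subseteq> ?L"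
  proof
    fix x assume "x \<in> ?f ` ?S"
    then obtain e P where x: "x = (\<lambda>w. add_mset w P) ` e" and e: "e \<in> edges G"
      and P: "P \<in> bounded_multisets (verts G) (\<lambda>w. if w \<in> e then s - 1 else s) (k - 1)"
      by auto
    from G e have sub: "e \<subseteq> verts G" and "card e = 2" by (auto simp: fin_simple_graph_def)
    then obtain u v where e_eq: "e = {u, v}" by (auto simp: card_2_iff)
    have cP: "count P w \<le> (if w \<in> e then s - 1 else s)" if "w \<in> verts G" for w
      using P that by (auto simp: bounded_multisets_def)
    have conf: "add_mset w P \<in> token_configs (verts G) k s" if "w \<in> e" for w
    proof -
      have "count (add_mset w P) y \<le> s" if "y \<in> verts G" for y
        using cP[OF that] \<open>w \<in> e\<close> \<open>0 < s\<close> by (auto split: if_splits)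
      then show ?thesis
        using P sub that \<open>0 < k\<close> by (auto simp: token_configs_def bounded_multisets_def)
    qed
    have "token_move G (add_mset u P) (add_mset v P)"
      unfolding token_move_def using e e_eq by (intro exI[of _ u] exI[of _ v]) simp
    then show "x \<in> ?L"
      using conf[of u] conf[of v] e_eq x by (auto simp: supertoken_graph_def)
  qed
qed

text \<open>The two multisets obtained from distinct endpoints intersect exactly in
  \<open>P\<close>. Once \<open>P\<close> is recovered, injectivity of adding a vertex to it
  recovers \<open>e\<close>.\<close>

lemma add_mset_image_inj:
  assumes eq: "(\<lambda>w. add_mset w P) ` e = (\<lambda>w. add_mset w P') ` e'"
    and "card e = 2" "card e' = 2"
  shows "e = e' \<and> P = P'"
proof -
  have inter: "add_mset u Q \<inter># add_mset v Q = Q" if "u \<noteq> v" for u v :: 'a and Q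
    using that by (intro multiset_eqI) auto
  obtain u v where e: "e = {u, v}" "u \<noteq> v" using assms(2) by (auto simp: card_2_iff)
  obtain u' v' where e': "e' = {u', v'}" "u' \<noteq> v'" using assms(3) by (auto simp: card_2_iff)
  have "{add_mset u P, add_mset v P} = {add_mset u' P', add_mset v' P'}"
    using eq e e' by simp
  \<comment> \<open>The two pairs may match in either order; commutativity of the intersection makes
    the order irrelevant.\<close>
  then have "add_mset u P \<inter># add_mset v P = add_mset u' P' \<inter># add_mset v' P'"
    unfolding doubleton_eq_iff by (elim disjE conjE) (simp_all only: subset_mset.inf.commute)
  then have "P = P'" using inter e(2) e'(2) by simp
  moreover have "inj (\<lambda>w. add_mset w P)" by (auto simp: inj_def)
  ultimately show ?thesis using eq by (simp add: inj_image_eq_iff)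
qed

text \<open>All edges of \<open>G\<close> contribute equally: the two endpoints give factors
  \<open>fps_geom (s - 1)\<close>, the other vertices factors \<open>fps_geom s\<close>.\<close>

lemma card_edges_supertoken_graph:
  assumes G: "fin_simple_graph G" and "0 < k" "0 < s"
  shows "real (card (edges (supertoken_graph G k s))) =
    real (card (edges G)) * (fps_geom (s - 1) ^ 2 * fps_geom s ^ (card (verts G) - 2)) $ (k - 1)"
proof -
  let ?b = "\<lambda>e w. if w \<in> e then s - 1 else s"
  let ?S = "SIGMA e:edges G. bounded_multisets (verts G) (?b e) (k - 1)"
  have finV: "finite (verts G)" using G by (simp add: fin_simple_graph_def)
  have "edges G \<subseteq> Pow (verts G)" using G by (auto simp: fin_simple_graph_def)
  then have finE: "finite (edges G)" using finV by (meson finite_Pow_iff finite_subset)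
  have "inj_on (\<lambda>(e, P). (\<lambda>w. add_mset w P) ` e) ?S"
  proof (rule inj_onI, clarify)
    fix e e' P P'
    assume "e \<in> edges G" "e' \<in> edges G"
      and eq: "(\<lambda>w. add_mset w P) ` e = (\<lambda>w. add_mset w P') ` e'"
    then have "card e = 2" "card e' = 2" using G by (auto simp: fin_simple_graph_def)
    then show "e = e' \<and> P = P'" using add_mset_image_inj[OF eq] by blast
  qed
  then have "card (edges (supertoken_graph G k s)) = card ?S"
    unfolding edges_supertoken_graph[OF assms] by (rule card_image)
  also have "\<dots> = (\<Sum>e\<in>edges G. card (bounded_multisets (verts G) (?b e) (k - 1)))"
    using finE finV by (intro card_SigmaI) (auto simp: finite_bounded_multisets)
  also have "real \<dots> = (\<Sum>e\<in>edges G.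
      (fps_geom (s - 1) ^ 2 * fps_geom s ^ (card (verts G) - 2)) $ (k - 1))"
    unfolding of_nat_sum
  proof (rule sum.cong[OF refl])
    fix e assume "e \<in> edges G"
    then have sub: "e \<subseteq> verts G" and card_e: "card e = 2"
      using G by (auto simp: fin_simple_graph_def)
    have fin_e: "finite e" using sub finV by (rule finite_subset)
    have "(\<Prod>w\<in>verts G. fps_geom (?b e w)) =
        (\<Prod>w\<in>verts G - e. fps_geom (?b e w)) * (\<Prod>w\<in>e. fps_geom (?b e w))"
      by (rule prod.subset_diff[OF sub finV])
    also have "\<dots> = fps_geom s ^ (card (verts G) - 2) * fps_geom (s - 1) ^ 2"
      by (simp add: card_Diff_subset[OF fin_e sub] card_e)
    finally show "real (card (bounded_multisets (verts G) (?b e) (k - 1))) =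
        (fps_geom (s - 1) ^ 2 * fps_geom s ^ (card (verts G) - 2)) $ (k - 1)"
      by (simp add: card_bounded_multisets[OF finV] mult.commute)
  qed
  finally show ?thesis by simp
qed

section \<open>The size formula\<close>

lemma fps_geom_square_nth:
  "(fps_geom r ^ 2) $ t =
    (if t \<le> r then real t + 1 else if t \<le> 2 * r then real (2 * r + 1 - t) else 0)"
proof -
  \<comment> \<open>A term is nonzero when both \<open>i\<close> and \<open>t - i\<close> are at
    most \<open>r\<close>; truncation in \<open>t - r\<close> supplies the lower limit 0 when
    \<open>t \<le> r\<close>.\<close>
  have "(fps_geom r ^ 2) $ t = (\<Sum>i\<in>{t - r..min t r}. 1)"
    unfolding power2_eq_square fps_mult_nth
    by (rule sum.mono_neutral_cong_right) auto
  also have "\<dots> = real (Suc (min t r) - (t - r))" by simp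
  finally show ?thesis by (auto simp: min_def of_nat_diff)
qed

lemma sum_int_reindex_shift: "(\<Sum>i = 1..int m. f i) = (\<Sum>t<m. f (int t + 1))"
  by (rule sum.reindex_bij_witness[of _ "\<lambda>t. int t + 1" "\<lambda>i. nat (i - 1)"]) auto

theorem proposition4p1:
  fixes G :: "'a graph" and n k s :: nat and \<omega> :: int
  assumes "fin_simple_graph G"
    and "card (verts G) = n"
    and "1 < s" and "s < k"
    and "\<omega> = min (2 * int s - 2) (int k - 1)"
  shows "real (card (verts (supertoken_graph G k s))) = token_count (int n) (int k) (int s)
    \<and> real (card (edges (supertoken_graph G k s))) =
        real (card (edges G)) *
          ((\<Sum>i = 1..int s. of_int i * token_count (int n - 2) (int k - i) (int s)) +
           (\<Sum>j = 1..\<omega> - int s + 1.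
              of_int (int s - j) * token_count (int n - 2) (int k - int s - j) (int s)))"
proof
  have finV: "finite (verts G)" using assms(1) by (simp add: fin_simple_graph_def)
  show "real (card (verts (supertoken_graph G k s))) = token_count (int n) (int k) (int s)"
    using assms(2) finV
    by (simp add: supertoken_graph_def token_configs_eq card_bounded_multisets token_count_eq_fps_nth)
next
  have card_E: "real (card (edges (supertoken_graph G k s))) =
      real (card (edges G)) * (fps_geom (s - 1) ^ 2 * fps_geom s ^ (n - 2)) $ (k - 1)"
    using card_edges_supertoken_graph[OF assms(1), of k s] assms(2-4) by simp
  let ?A = "\<Sum>i = 1..int s. of_int i * token_count (int n - 2) (int k - i) (int s)"
  let ?B = "\<Sum>j = 1..\<omega> - int s + 1.
      of_int (int s - j) * token_count (int n - 2) (int k - int s - j) (int s)"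
  show "real (card (edges (supertoken_graph G k s))) = real (card (edges G)) * (?A + ?B)"
  \<comment> \<open>Without edges \<open>n - 2\<close> may be negative as an integer, but both sides
    are 0. An edge forces \<open>2 \<le> n\<close>, so that integer and natural subtraction
    agree.\<close>
  proof (cases "edges G = {}")
    case True
    then show ?thesis using card_E by simp
  next
    case False
    then obtain e where e: "e \<subseteq> verts G" "card e = 2"
      using assms(1) by (auto simp: fin_simple_graph_def)
    have "2 \<le> n"
      using card_mono[OF _ e(1)] e(2) assms(1,2) by (auto simp: fin_simple_graph_def)
    then have n2: "int n - 2 = int (n - 2)" by simp
    \<comment> \<open>The length of the second sum: the degree \<open>s + t\<close> may exceed
      neither \<open>2 * s - 2\<close>, the degree of the squared factor, nor \<open>k - 1\<close>,
      the number of tokens that stay.\<close>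
    define m where "m = min (s - 1) (k - s)"
    have \<omega>: "\<omega> - int s + 1 = int m" using assms(3-5) by (auto simp: m_def min_def)
    \<comment> \<open>For a fixed edge of \<open>G\<close>, \<open>h t\<close> counts the placements
      of the \<open>k - 1\<close> staying tokens with exactly \<open>t\<close> of them on its
      endpoints.\<close>
    define h where "h t = (fps_geom (s - 1) ^ 2) $ t * (fps_geom s ^ (n - 2)) $ (k - 1 - t)" for t
    \<comment> \<open>The rising coefficients 1, ..., \<open>s\<close> of the square, with
      \<open>i = t + 1\<close>.\<close>
    have "?A = (\<Sum>t<s. h t)"
      unfolding sum_int_reindex_shift
    proof (rule sum.cong[OF refl])
      fix t assume "t \<in> {..<s}"
      then have t: "t < s" by simp
      then have "int k - (int t + 1) = int (k - 1 - t)" using assms(4) by linarith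
      then show "of_int (int t + 1) * token_count (int n - 2) (int k - (int t + 1)) (int s) = h t"
        using t assms(3) by (simp only: n2 token_count_eq_fps_nth h_def)
          (simp add: fps_geom_square_nth)
    qed
    \<comment> \<open>The falling coefficients: with \<open>j = t + 1\<close>, the one at degree
      \<open>s + t\<close> is \<open>2 * (s - 1) + 1 - (s + t) = s - j\<close>.\<close>
    moreover have "?B = (\<Sum>t<m. h (s + t))"
      unfolding \<omega> sum_int_reindex_shift
    proof (rule sum.cong[OF refl])
      fix t assume "t \<in> {..<m}"
      then have t: "t < s - 1" "t < k - s" by (auto simp: m_def)
      then have "int k - int s - (int t + 1) = int (k - 1 - (s + t))" by linarith
      moreover have "(fps_geom (s - 1) ^ 2) $ (s + t) = of_int (int s - (int t + 1))"
      proof -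
        have "\<not> s + t \<le> s - 1" "s + t \<le> 2 * (s - 1)" using t assms(3) by linarith+
        then show ?thesis using t assms(3) by (simp add: fps_geom_square_nth of_nat_diff)
      qed
      ultimately show "of_int (int s - (int t + 1)) *
          token_count (int n - 2) (int k - int s - (int t + 1)) (int s) = h (s + t)"
        by (simp only: n2 token_count_eq_fps_nth h_def)
    qed
    moreover have "(\<Sum>t<s. h t) + (\<Sum>t<m. h (s + t)) = (\<Sum>t<s + m. h t)"
      by (induction m) (simp_all add: add.assoc)
    \<comment> \<open>If \<open>m = s - 1\<close>, the omitted degrees start at
      \<open>2 * s - 1\<close>, where the square has coefficient 0; if \<open>m = k - s\<close>,
      then \<open>s + m = k\<close> and nothing is omitted.\<close>
    moreover have "\<dots> = (\<Sum>t=0..k - 1. h t)"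
      using assms(3,4)
      by (intro sum.mono_neutral_left) (auto simp: m_def h_def fps_geom_square_nth min_def split: if_splits)
    ultimately show ?thesis
      using card_E by (simp add: fps_mult_nth h_def)
  qed
qed

end
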